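(* Let $i\ge 2$ and suppose that every CAV $z\in\{2,\ldots,i\}$ satisfies the following three conditions (each clause being vacuous, or the corresponding term being omitted from the maximum, when the set of CAVs defining $k_z$, $c_z$ or $o_z$ is empty), where $k_z=\max\{y: y\in\mathcal{L}_z(t)\}$, $c_z=\max\{y: y\in\mathcal{C}_z(t)\}$, $o_z=\max\{y: y\in\mathcal{O}_z(t)\cup\mathcal{R}_z(t)\}$: (a) (rear-end safety) $p_{k_z}(t)-p_z(t)\ge \varphi v_z(t)+\delta_0$ for all $t\in[t_z^0,t_z^f]$; (b) (lateral safety) $t_z^m\ge t_{c_z}^f$; (c) (terminal time lower bound) $t_z^f\ge\max\Big\{t_z^L,\; t_{k_z}^f+\frac{\varphi v_z^f+\delta_0}{v_{k_z}^f},\; t_{o_z}^f\Big\}$. Then, for every CAV $j<i$: 1. if $j\in\mathcal{L}_i(t)$, then $p_j(t)-p_i(t)\ge\varphi v_i(t)+\delta_0$ for all $t\in[t_i^0,t_i^f]$ (no rear-end collision); 2. if $j\in\mathcal{C}_i(t)$, then $t_i^m\ge t_j^f$ (no lateral collision inside the merging zone); 3. $t_i^f\ge t_j^f$ (the crossing order is preserved).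
   Context: Setting. Two roads cross at an intersection. Each road may have several lanes in each of its two directions. The central region is a square of side $S>0$, the Merging Zone (MZ). Each approach to it is a Control Zone (CZ) segment of length $L>S$. Connected automated vehicles (CAVs) are numbered $1,2,3,\ldots$ in the order in which they enter the CZ (ties broken arbitrarily), so $t_j^0\le t_i^0$ for $j<i$. For CAV $i$, $t_i^0$ is the time it enters the CZ, $t_i^m$ the time it enters the MZ (position $L$), and $t_i^f\ge t_i^m$ the time it exits the MZ (position $L+S$). Its position $p_i(t)$ (distance travelled since entering the CZ) and speed $v_i(t)$ satisfy $\dot p_i=v_i$, $\dot v_i=u_i$, $p_i(t_i^0)=0$, $p_i(t_i^m)=L$, $p_i(t_i^f)=L+S$, with $u_{i,\min}\le u_i(t)\le u_{i,\max}$ and $0\le v_{\min}\le v_i(t)\le v_{\max}$ on $[t_i^0,t_i^f]$. Write $v_i^0=v_i(t_i^0)$ and $v_i^f=v_i(t_i^f)$. No overtaking, direction reversal, lane changing or turns are allowed; in particular, if $j<k$ travel on the same lane, then $p_k(t)\le p_j(t)$ at all times when both are defined. After exiting the MZ a CAV keeps its exit speed, so $p_j(t)=L+S+v_j^f(t-t_j^f)$ for $t\ge t_j^f$. Exit speeds appearing in denominators are taken to be positive. Classification. With respect to CAV $i$, each earlier CAV $j<i$ belongs to exactly one of the following sets: $\mathcal{R}_i(t)$, the CAVs on the same road as $i$, in the same direction but on different lanes; $\mathcal{L}_i(t)$, the CAVs on the same road and lane as $i$; $\mathcal{C}_i(t)$, the CAVs on the other road, with destinations that can cause a collision with $i$ in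 the MZ; $\mathcal{O}_i(t)$, the CAVs on the same road as $i$ travelling in the opposite direction, which cannot collide with $i$ in the MZ. Since lane changes and turns are excluded, membership does not change with $t$. Constants: $\varphi>0$ is the reaction time and $\delta_0\ge0$ the minimal standstill inter-vehicle distance. The time $t_i^L$ is $t_i^L=t_i^1\,\mathbf{1}_{\{v_i^f=v_{\max}\}}+t_i^2\,(1-\mathbf{1}_{\{v_i^f=v_{\max}\}})$ with $$t_i^1=t_i^0+\frac{L+S}{v_{\max}}+\frac{(v_{\max}-v_i^0)^2}{2u_{i,\max}v_{\max}},\qquad t_i^2=t_i^0+\frac{[2(L+S)u_{i,\max}+(v_i^0)^2]^{1/2}-v_i^0}{u_{i,\max}}.$$ *)

theory Defs
  imports "HOL-Analysis.Analysis"
begin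

datatype road = Road_A | Road_B

datatype direction = Forward | Backward

text \<open>
  Lanes are numbered separately for each road and direction, so a physical lane is a triple
  (road, direction, lane number).  Since lane changes, turns and direction reversals are
  excluded, none of the three depends on time.  The relation \<open>can_collide j i\<close> says that the
  destinations of \<open>j\<close> and \<open>i\<close> can cause a collision of the two CAVs in the merging zone; it is
  left abstract and only constrained through the classification of earlier CAVs below.
\<close>

record traffic =
  mz_side :: real                      \<comment> \<open>$S$\<close>
  cz_length :: real                    \<comment> \<open>$L$\<close>
  v_min :: real
  v_max :: real
  reaction_time :: real                \<comment> \<open>$\varphi$\<close>
  standstill_dist :: real              \<comment> \<open>$\delta_0$\<close>
  cavs :: "nat set"
  road_of :: "nat \<Rightarrow> road"
  dir_of :: "nat \<Rightarrow> direction"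
  lane_of :: "nat \<Rightarrow> nat"
  can_collide :: "nat \<Rightarrow> nat \<Rightarrow> bool"
  u_min :: "nat \<Rightarrow> real"
  u_max :: "nat \<Rightarrow> real"
  t_enter :: "nat \<Rightarrow> real"              \<comment> \<open>$t_i^0$\<close>
  t_merge :: "nat \<Rightarrow> real"              \<comment> \<open>$t_i^m$\<close>
  t_exit :: "nat \<Rightarrow> real"               \<comment> \<open>$t_i^f$\<close>
  pos :: "nat \<Rightarrow> real \<Rightarrow> real"          \<comment> \<open>$p_i(t)$\<close>
  vel :: "nat \<Rightarrow> real \<Rightarrow> real"          \<comment> \<open>$v_i(t)$\<close>
  acc :: "nat \<Rightarrow> real \<Rightarrow> real"          \<comment> \<open>$u_i(t)$\<close>

definition v_enter :: "traffic \<Rightarrow> nat \<Rightarrow> real" where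
  "v_enter T i = vel T i (t_enter T i)"

definition v_exit :: "traffic \<Rightarrow> nat \<Rightarrow> real" where
  "v_exit T i = vel T i (t_exit T i)"

definition R_set :: "traffic \<Rightarrow> nat \<Rightarrow> nat set" where
  "R_set T i = {j. 1 \<le> j \<and> j < i \<and> road_of T j = road_of T i \<and> dir_of T j = dir_of T i \<and>
                   lane_of T j \<noteq> lane_of T i}"

definition L_set :: "traffic \<Rightarrow> nat \<Rightarrow> nat set" where
  "L_set T i = {j. 1 \<le> j \<and> j < i \<and> road_of T j = road_of T i \<and> dir_of T j = dir_of T i \<and>
                   lane_of T j = lane_of T i}"

definition C_set :: "traffic \<Rightarrow> nat \<Rightarrow> nat set" where
  "C_set T i = {j. 1 \<le> j \<and> j < i \<and> road_of T j \<noteq> road_of T i \<and> can_collide T j i}"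

definition O_set :: "traffic \<Rightarrow> nat \<Rightarrow> nat set" where
  "O_set T i = {j. 1 \<le> j \<and> j < i \<and> road_of T j = road_of T i \<and> dir_of T j \<noteq> dir_of T i \<and>
                   \<not> can_collide T j i}"

text \<open>
  No CAV belongs to two of these sets; that every earlier CAV belongs to one of them is part of
  \<open>valid_traffic\<close> below.
\<close>

lemma classification_disjoint:
  "R_set T i \<inter> L_set T i = {}" "R_set T i \<inter> C_set T i = {}" "R_set T i \<inter> O_set T i = {}"
  "L_set T i \<inter> C_set T i = {}" "L_set T i \<inter> O_set T i = {}" "C_set T i \<inter> O_set T i = {}"
  by (auto simp: R_set_def L_set_def C_set_def O_set_def)

text \<open>The following three are meaningful only if the respective set is nonempty.\<close>

definition k_idx :: "traffic \<Rightarrow> nat \<Rightarrow> nat" where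
  "k_idx T z = Max (L_set T z)"

definition c_idx :: "traffic \<Rightarrow> nat \<Rightarrow> nat" where
  "c_idx T z = Max (C_set T z)"

definition o_idx :: "traffic \<Rightarrow> nat \<Rightarrow> nat" where
  "o_idx T z = Max (O_set T z \<union> R_set T z)"

text \<open>
  The speed equation is understood in the integrated (Caratheodory) sense, since controls may be
  discontinuous (e.g. maximal acceleration followed by cruising at maximal speed).
\<close>

definition cav_dynamics :: "traffic \<Rightarrow> nat \<Rightarrow> bool" where
  "cav_dynamics T i \<longleftrightarrow>
     t_enter T i \<le> t_merge T i \<and> t_merge T i \<le> t_exit T i \<and>
     (\<forall>t\<in>{t_enter T i..t_exit T i}.
        (pos T i has_real_derivative vel T i t) (at t within {t_enter T i..t_exit T i}) \<and>
        (acc T i has_integral (vel T i t - vel T i (t_enter T i))) {t_enter T i..t} \<and>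
        u_min T i \<le> acc T i t \<and> acc T i t \<le> u_max T i \<and>
        v_min T \<le> vel T i t \<and> vel T i t \<le> v_max T) \<and>
     pos T i (t_enter T i) = 0 \<and>
     pos T i (t_merge T i) = cz_length T \<and>
     pos T i (t_exit T i) = cz_length T + mz_side T \<and>
     (\<forall>t\<ge>t_exit T i. vel T i t = v_exit T i \<and>
        pos T i t = cz_length T + mz_side T + v_exit T i * (t - t_exit T i))"

text \<open>
  The CAVs are numbered 1, 2, 3, ...; the set of their numbers is an initial segment of the
  positive integers, finite or infinite.
\<close>

definition valid_traffic :: "traffic \<Rightarrow> bool" where
  "valid_traffic T \<longleftrightarrow>
     0 < mz_side T \<and> mz_side T < cz_length T \<and> 0 \<le> v_min T \<and>
     0 < reaction_time T \<and> 0 \<le> standstill_dist T \<and>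
     0 \<notin> cavs T \<and> (\<forall>i\<in>cavs T. {1..i} \<subseteq> cavs T) \<and>
     (\<forall>i\<in>cavs T. cav_dynamics T i) \<and>
     (\<forall>i\<in>cavs T. \<forall>j\<in>cavs T. j < i \<longrightarrow> t_enter T j \<le> t_enter T i) \<and>
     (\<forall>i\<in>cavs T. \<forall>j\<in>L_set T i. \<forall>t. t_enter T j \<le> t \<and> t_enter T i \<le> t \<longrightarrow> pos T i t \<le> pos T j t) \<and>
     (\<forall>i\<in>cavs T. {1..<i} = R_set T i \<union> L_set T i \<union> C_set T i \<union> O_set T i) \<and>
     (\<forall>i\<in>cavs T. L_set T i \<noteq> {} \<longrightarrow> 0 < v_exit T (k_idx T i))"

definition t1 :: "traffic \<Rightarrow> nat \<Rightarrow> real" where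
  "t1 T i = t_enter T i + (cz_length T + mz_side T) / v_max T
            + (v_max T - v_enter T i)\<^sup>2 / (2 * u_max T i * v_max T)"

definition t2 :: "traffic \<Rightarrow> nat \<Rightarrow> real" where
  "t2 T i = t_enter T i
            + (sqrt (2 * (cz_length T + mz_side T) * u_max T i + (v_enter T i)\<^sup>2) - v_enter T i)
              / u_max T i"

definition t_L :: "traffic \<Rightarrow> nat \<Rightarrow> real" where
  "t_L T i = t1 T i * of_bool (v_exit T i = v_max T)
             + t2 T i * (1 - of_bool (v_exit T i = v_max T))"

definition rear_end_gap :: "traffic \<Rightarrow> nat \<Rightarrow> nat \<Rightarrow> bool" where
  "rear_end_gap T j i \<longleftrightarrow>
     (\<forall>t\<in>{t_enter T i..t_exit T i}.
        pos T j t - pos T i t \<ge> reaction_time T * vel T i t + standstill_dist T)"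

definition rear_end_safety :: "traffic \<Rightarrow> nat \<Rightarrow> bool" where
  "rear_end_safety T z \<longleftrightarrow> (L_set T z \<noteq> {} \<longrightarrow> rear_end_gap T (k_idx T z) z)"

definition lateral_safety :: "traffic \<Rightarrow> nat \<Rightarrow> bool" where
  "lateral_safety T z \<longleftrightarrow> (C_set T z \<noteq> {} \<longrightarrow> t_merge T z \<ge> t_exit T (c_idx T z))"

definition terminal_time_bound :: "traffic \<Rightarrow> nat \<Rightarrow> bool" where
  "terminal_time_bound T z \<longleftrightarrow>
     t_exit T z \<ge>
       Max ({t_L T z}
            \<union> (if L_set T z = {} then {}
               else {t_exit T (k_idx T z)
                     + (reaction_time T * v_exit T z + standstill_dist T) / v_exit T (k_idx T z)})
            \<union> (if O_set T z \<union> R_set T z = {} then {} else {t_exit T (o_idx T z)}))"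

end

theory Submission
  imports Defs
begin

text \<open>
  The conditions constrain a CAV \<open>z\<close> only relative to the \<^emph>\<open>latest\<close> earlier CAV of each class,
  and the point is that this controls all the others.  For exit times the argument is an
  induction along the numbering.  Every \<open>j < z\<close> lies in some class of \<open>z\<close>, whose largest member
  \<open>m\<close> satisfies \<open>j \<le> m < z\<close> and exits no later than \<open>z\<close>, by lateral safety for the crossing
  class and by the terminal time bound for the others (\<open>earlier_exit_via_class_maximum\<close>).
  Whichever class of \<open>m\<close> the CAV \<open>j\<close> belongs to, the induction hypothesis for \<open>m\<close> says that
  \<open>j\<close> exits no later than \<open>m\<close>.  Hence exit times are monotone in the numbering
  (\<open>exit_times_mono\<close>), and \<open>t_merge T i \<ge> t_exit T (c_idx T i)\<close> extends to every
  crossing CAV.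

  The rear-end gap needs no induction: a CAV on the same lane other than the immediate
  predecessor \<open>k\<close> is also on the lane of \<open>k\<close> and, since overtaking is excluded, never behind
  it, so its gap to \<open>i\<close> is at least that of \<open>k\<close>.
\<close>

lemma finite_class_sets [simp]:
  "finite (L_set T i)" "finite (C_set T i)" "finite (O_set T i \<union> R_set T i)"
  by (rule finite_subset [of _ "{..<i}"];
      auto simp: L_set_def C_set_def O_set_def R_set_def)+

lemma k_idx_in_L_set: "j \<in> L_set T i \<Longrightarrow> k_idx T i \<in> L_set T i"
  unfolding k_idx_def by (rule Max_in) auto

lemma le_k_idx: "j \<in> L_set T i \<Longrightarrow> j \<le> k_idx T i"
  unfolding k_idx_def by (rule Max_ge) auto

lemma c_idx_in_C_set: "j \<in> C_set T i \<Longrightarrow> c_idx T i \<in> C_set T i"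
  unfolding c_idx_def by (rule Max_in) auto

lemma le_c_idx: "j \<in> C_set T i \<Longrightarrow> j \<le> c_idx T i"
  unfolding c_idx_def by (rule Max_ge) auto

lemma o_idx_in_O_R_set: "j \<in> O_set T i \<union> R_set T i \<Longrightarrow> o_idx T i \<in> O_set T i \<union> R_set T i"
  unfolding o_idx_def by (rule Max_in) (use finite_class_sets(3) in blast)+

lemma le_o_idx: "j \<in> O_set T i \<union> R_set T i \<Longrightarrow> j \<le> o_idx T i"
  unfolding o_idx_def by (rule Max_ge) (use finite_class_sets(3) in blast)+

lemma terminal_time_bound_L:
  assumes "terminal_time_bound T z" "j \<in> L_set T z"
  shows "t_exit T (k_idx T z)
           + (reaction_time T * v_exit T z + standstill_dist T) / v_exit T (k_idx T z)
         \<le> t_exit T z"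
proof -
  have "L_set T z \<noteq> {}" using assms(2) by blast
  then show ?thesis
    by (intro order_trans [OF Max_ge assms(1) [unfolded terminal_time_bound_def]]) simp_all
qed

lemma terminal_time_bound_O_R:
  assumes "terminal_time_bound T z" "j \<in> O_set T z \<union> R_set T z"
  shows "t_exit T (o_idx T z) \<le> t_exit T z"
proof -
  have "O_set T z \<union> R_set T z \<noteq> {}" using assms(2) by blast
  then show ?thesis
    by (intro order_trans [OF Max_ge assms(1) [unfolded terminal_time_bound_def]])
      (simp_all only: if_False finite_insert finite.emptyI finite_Un Un_iff insert_iff simp_thms
        split: if_split)
qed

lemma v_exit_nonneg:
  assumes "valid_traffic T" "z \<in> cavs T"
  shows "0 \<le> v_exit T z"
proof -
  have dyn: "cav_dynamics T z" and "0 \<le> v_min T"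
    using assms unfolding valid_traffic_def by blast+
  moreover have "t_exit T z \<in> {t_enter T z..t_exit T z}"
    using dyn unfolding cav_dynamics_def by auto
  ultimately have "v_min T \<le> vel T z (t_exit T z)"
    unfolding cav_dynamics_def by blast
  then show ?thesis
    using \<open>0 \<le> v_min T\<close> unfolding v_exit_def by linarith
qed

text \<open>
  This is the induction step for the exit order: \<open>m\<close> is the largest member of the class of \<open>j\<close>
  with respect to \<open>z\<close>.  In the same-lane case the terminal time bound adds to the exit time of
  \<open>m\<close> the headway \<open>(\<phi> v + \<delta>\<^sub>0) / v'\<close>, which is nonnegative because speeds are nonnegative
  and the exit speed of \<open>m\<close> is positive; in the crossing case \<open>z\<close> does not even enter the merging
  zone before \<open>m\<close> has left it.
\<close>

lemma earlier_exit_via_class_maximum: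
  assumes valid: "valid_traffic T" and z: "z \<in> cavs T"
    and lateral: "lateral_safety T z" and terminal: "terminal_time_bound T z"
    and j: "1 \<le> j" "j < z"
  obtains m where "j \<le> m" "m < z" "t_exit T m \<le> t_exit T z"
proof -
  have "j \<in> R_set T z \<union> L_set T z \<union> C_set T z \<union> O_set T z"
    using valid z j unfolding valid_traffic_def by fastforce
  then consider "j \<in> L_set T z" | "j \<in> C_set T z" | "j \<in> O_set T z \<union> R_set T z"
    by blast
  then show thesis
  proof cases
    case 1
    have "0 < v_exit T (k_idx T z)" "0 < reaction_time T" "0 \<le> standstill_dist T"
      using valid z 1 unfolding valid_traffic_def by blast+
    then have "0 \<le> (reaction_time T * v_exit T z + standstill_dist T) / v_exit T (k_idx T z)"
      using v_exit_nonneg [OF valid z] by simp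
    then have "t_exit T (k_idx T z) \<le> t_exit T z"
      using terminal_time_bound_L [OF terminal 1] by linarith
    moreover have "k_idx T z < z"
      using k_idx_in_L_set [OF 1] by (simp add: L_set_def)
    ultimately show thesis
      using that le_k_idx [OF 1] by blast
  next
    case 2
    have "t_exit T (c_idx T z) \<le> t_merge T z"
      using lateral 2 unfolding lateral_safety_def by blast
    also have "t_merge T z \<le> t_exit T z"
      using valid z unfolding valid_traffic_def cav_dynamics_def by blast
    finally have "t_exit T (c_idx T z) \<le> t_exit T z" .
    moreover have "c_idx T z < z"
      using c_idx_in_C_set [OF 2] by (simp add: C_set_def)
    ultimately show thesis
      using that le_c_idx [OF 2] by blast
  next
    case 3
    have "o_idx T z < z"
      using o_idx_in_O_R_set [OF 3] by (auto simp: O_set_def R_set_def)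
    then show thesis
      using that le_o_idx [OF 3] terminal_time_bound_O_R [OF terminal 3] by blast
  qed
qed

lemma exit_times_mono:
  assumes valid: "valid_traffic T" and i: "i \<in> cavs T"
    and safe: "\<forall>z\<in>{2..i}. lateral_safety T z \<and> terminal_time_bound T z"
    and "1 \<le> j" "j \<le> z" "z \<le> i"
  shows "t_exit T j \<le> t_exit T z"
  using \<open>j \<le> z\<close> \<open>z \<le> i\<close>
proof (induction z rule: less_induct)
  case (less z)
  show ?case
  proof (cases "j = z")
    case False
    then have "j < z" "z \<in> {2..i}"
      using less.prems \<open>1 \<le> j\<close> by auto
    moreover have "z \<in> cavs T"
      using valid i \<open>z \<in> {2..i}\<close> unfolding valid_traffic_def by force
    ultimately obtain m where "j \<le> m" "m < z" "t_exit T m \<le> t_exit T z"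
      using earlier_exit_via_class_maximum valid safe \<open>1 \<le> j\<close> by metis
    then show ?thesis
      using less.IH [of m] less.prems by simp
  qed simp
qed

text \<open>
  Being on the same lane is transitive, so \<open>j\<close> is at or ahead of \<open>k_idx T i\<close> from the moment the
  latter enters; this covers the whole time that \<open>i\<close> spends in the control and merging zones, as
  \<open>i\<close> enters no earlier than \<open>k_idx T i\<close>.
\<close>

lemma k_idx_not_ahead:
  assumes valid: "valid_traffic T" and i: "i \<in> cavs T" and j: "j \<in> L_set T i"
    and t: "t_enter T i \<le> t"
  shows "pos T (k_idx T i) t \<le> pos T j t"
proof (cases "j = k_idx T i")
  case False
  let ?k = "k_idx T i"
  have k: "?k \<in> L_set T i" and "j < ?k"
    using k_idx_in_L_set [OF j] le_k_idx [OF j] False by auto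
  then have "j \<in> L_set T ?k"
    using j by (simp add: L_set_def)
  have "?k < i" "1 \<le> ?k" "1 \<le> j"
    using k j by (auto simp: L_set_def)
  moreover have "{1..i} \<subseteq> cavs T"
    using valid i unfolding valid_traffic_def by blast
  ultimately have cavs: "?k \<in> cavs T" "j \<in> cavs T"
    using \<open>j < ?k\<close> by auto
  have "t_enter T ?k \<le> t_enter T i" "t_enter T j \<le> t_enter T ?k"
    using valid i cavs \<open>?k < i\<close> \<open>j < ?k\<close> unfolding valid_traffic_def by blast+
  then have "t_enter T j \<le> t" "t_enter T ?k \<le> t"
    using t by linarith+
  then show ?thesis
    using valid cavs(1) \<open>j \<in> L_set T ?k\<close> unfolding valid_traffic_def by blast
qed simp

theorem theorem1:
  fixes T :: traffic and i :: nat
  assumes "valid_traffic T"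
    and "i \<in> cavs T" and "i \<ge> 2"
    and "\<forall>z\<in>{2..i}. rear_end_safety T z \<and> lateral_safety T z \<and> terminal_time_bound T z"
  shows "\<forall>j\<in>{1..<i}.
           (j \<in> L_set T i \<longrightarrow>
              (\<forall>t\<in>{t_enter T i..t_exit T i}.
                 pos T j t - pos T i t \<ge> reaction_time T * vel T i t + standstill_dist T)) \<and>
           (j \<in> C_set T i \<longrightarrow> t_merge T i \<ge> t_exit T j) \<and>
           t_exit T i \<ge> t_exit T j"
proof (intro ballI conjI impI)
  have safe_i: "rear_end_safety T i" "lateral_safety T i"
    using assms(3,4) by auto
  have mono: "t_exit T j \<le> t_exit T z" if "1 \<le> j" "j \<le> z" "z \<le> i" for j z
    using exit_times_mono [OF assms(1,2) _ that] assms(4) by blast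
  fix j assume j: "j \<in> {1..<i}"
  show "t_exit T j \<le> t_exit T i"
    using mono j by simp
  {
    fix t assume jL: "j \<in> L_set T i" and t: "t \<in> {t_enter T i..t_exit T i}"
    have "reaction_time T * vel T i t + standstill_dist T \<le> pos T (k_idx T i) t - pos T i t"
      using safe_i(1) jL t unfolding rear_end_safety_def rear_end_gap_def by blast
    also have "\<dots> \<le> pos T j t - pos T i t"
      using k_idx_not_ahead [OF assms(1,2) jL] t by simp
    finally show "reaction_time T * vel T i t + standstill_dist T \<le> pos T j t - pos T i t" .
  }
  assume jC: "j \<in> C_set T i"
  have "t_exit T j \<le> t_exit T (c_idx T i)"
    using c_idx_in_C_set [OF jC] le_c_idx [OF jC] j by (intro mono) (auto simp: C_set_def)
  also have "\<dots> \<le> t_merge T i"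
    using safe_i(2) jC unfolding lateral_safety_def by blast
  finally show "t_exit T j \<le> t_merge T i" .
qed

end
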